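(* Let $d\ge 1$ and $m\ge 1$ be integers. The function $(A,s)\mapsto M(A,s)$ is jointly continuous in $(A,s)$ on $(\mathrm{GL}_d(\mathbb{R}))^m\times[0,\infty)$, where for a tuple $A=(A_1,\ldots,A_m)$ of invertible linear maps on $\mathbb{R}^d$ and $s\ge 0$, $$M(A,s)=\lim_{n\to\infty}\frac1n\log\left(\sum_{(i_1\cdots i_n)\in\{1,\ldots,m\}^n}\|A_{i_n}\cdots A_{i_1}\|^s\right).$$
   Context: $\|\cdot\|$ is the Euclidean operator norm on $\mathbb{R}^{d\times d}$, and $(\mathrm{GL}_d(\mathbb{R}))^m$ carries the topology induced from $(\mathbb{R}^{d\times d})^m$. The limit defining $M(A,s)$ exists by subadditivity. *)

theory Defs
  imports "HOL-Analysis.Analysis"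
begin

text \<open>
  The dimension is \<open>d = CARD('d)\<close> and the number of matrices is \<open>m = CARD('m)\<close>; both are
  positive because types are nonempty.
\<close>

definition GL_tuples :: "(real^'d^'d^'m) set"
  where "GL_tuples = {A. \<forall>i. invertible (A $ i)}"

text \<open>
  \<^const>\<open>norm\<close> on \<open>real^'d^'d\<close> is the Frobenius norm. The norm used here is the operator norm
  induced by the Euclidean norm on \<open>real^'d\<close>.
\<close>

definition op_norm :: "real^'d^'d \<Rightarrow> real"
  where "op_norm B = onorm (\<lambda>x. B *v x)"

text \<open>
  The factors are multiplied on the left, so the word \<open>[i\<^sub>1, \<dots>, i\<^sub>n]\<close> is sent to
  \<open>A\<^sub>i\<^sub>n \<cdots> A\<^sub>i\<^sub>1\<close>.
\<close>

definition word_prod :: "real^'d^'d^'m \<Rightarrow> 'm list \<Rightarrow> real^'d^'d"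
  where "word_prod A w = fold (\<lambda>i P. (A $ i) ** P) w (mat 1)"

definition norm_sum :: "real^'d^'d^'m \<Rightarrow> real \<Rightarrow> nat \<Rightarrow> real"
  where "norm_sum A s n = (\<Sum>w\<in>{w. length w = n}. op_norm (word_prod A w) powr s)"

text \<open>
  The limit is meaningful for \<open>A \<in> GL_tuples\<close> and \<open>s \<ge> 0\<close>, where it exists by subadditivity.
  There every product is invertible and so has positive norm, and the
  convention \<open>0 powr s = 0\<close> plays no role.
\<close>

definition M :: "real^'d^'d^'m \<Rightarrow> real \<Rightarrow> real"
  where "M A s = lim (\<lambda>n. (1 / real n) * ln (norm_sum A s n))"

end

theory Submission
  imports Defs
begin

text \<open>
  Write \<open>P\<^sub>n\<close> for the sum of \<open>\<parallel>A\<^sub>w\<parallel>\<^sup>s\<close> over words \<open>w\<close> of length \<open>n\<close>, and \<open>\<rho>\<close> for the limit of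
  \<open>P\<^sub>n\<^sup>1\<^sup>/\<^sup>n\<close>, so that \<open>M A s = ln \<rho>\<close>. Submultiplicativity makes \<open>M\<close> the infimum of the continuous
  functions \<open>(1/n) ln P\<^sub>n\<close>; this is upper semicontinuity. The substance of the theorem is lower
  semicontinuity, and it follows if \<open>M\<close> is a supremum of continuous functions too. That is what the
  inequality
    \<open>P\<^sub>n P\<^sub>d\<^sub>n \<le> C \<rho>\<^sup>n P\<^sub>n\<^sup>d\<close>
  provides, where \<open>d\<close> is the dimension and \<open>C\<close> depends continuously on \<open>s\<close> and on nothing else but
  \<open>d\<close>. Its logarithm divided by \<open>n\<close> reads
    \<open>(1/n) (ln P\<^sub>n + ln P\<^sub>d\<^sub>n - d ln P\<^sub>n - ln C) \<le> M\<close>,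
  and for \<open>n \<rightarrow> \<infinity>\<close> the left-hand side tends to \<open>M + d M - d M = M\<close>. Here \<open>\<rho>\<^sup>n\<close> may be replaced by
  \<open>q\<^sup>n\<close> with \<open>q = P\<^sub>N\<^sup>1\<^sup>/\<^sup>N\<close> for arbitrary \<open>N \<ge> 1\<close>, so that only finite sums are involved; this is
  \<open>norm_sum_bochi_inequality\<close>. It is an analogue for sums of Bochi's inequality for the joint spectral
  radius.

  The inequality has three ingredients. First, a weighted sum \<open>f v\<close> of \<open>\<parallel>A\<^sub>w v\<parallel>\<^sup>s\<close> over words \<open>w\<close> shorter
  than \<open>N\<close> behaves like the \<open>s\<close>-th power of a norm, up to a factor in the triangle inequality, and
  satisfies \<open>\<Sum>\<^sub>i f (A\<^sub>i v) \<le> q f v\<close> (\<open>exists_contracted_powr_gauge\<close>). Second, some orthonormal basis \<open>B\<close>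
  diagonalises \<open>f\<close> up to a constant, in the sense that \<open>f e |v \<bullet> e|\<^sup>s \<le> K f v\<close>
  (\<open>powr_gauge_orthonormal_basis\<close>). This plays the part of a singular value decomposition of a change of
  norm. Third, consider the matrix entries of \<open>A\<^sub>w\<close> in \<open>B\<close> for \<open>|w| = n\<close>. Every entry from \<open>e\<close> to \<open>e'\<close>
  has \<open>s\<close>-th powers summing to at most \<open>P\<^sub>n\<close>, and to at most \<open>K q\<^sup>n\<close> when \<open>f e \<le> f e'\<close>. A product of
  \<open>d\<close> blocks expands over paths \<open>e\<^sub>0, \<dots>, e\<^sub>d\<close> in \<open>B\<close>. As \<open>B\<close> has only \<open>d\<close> elements, \<open>f\<close> cannot decrease
  strictly at each of the \<open>d\<close> steps of the path, so at least one step contributes \<open>K q\<^sup>n\<close> instead of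
  \<open>P\<^sub>n\<close> (\<open>entry_sum_block_bound\<close>).
\<close>

section \<open>Powers of sums and adapted orthonormal bases\<close>

lemma powr_sum_le:
  fixes x :: "'b \<Rightarrow> real"
  assumes "finite B" and nn: "\<And>b. b \<in> B \<Longrightarrow> 0 \<le> x b" and s: "0 \<le> s"
  shows "(\<Sum>b\<in>B. x b) powr s \<le> real (card B) powr s * (\<Sum>b\<in>B. x b powr s)"
proof (cases "B = {}")
  case False
  define y where "y = Max (x ` B)"
  have fin: "finite (x ` B)" and ne: "x ` B \<noteq> {}"
    using \<open>finite B\<close> False by auto
  obtain b where b: "b \<in> B" "x b = y"
    using Max_in[OF fin ne] unfolding y_def by auto
  have le: "x c \<le> y" if "c \<in> B" for c
    using that fin by (auto simp: y_def)
  have "(\<Sum>b\<in>B. x b) powr s \<le> (real (card B) * y) powr s"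
    using sum_bounded_above[of B x y] le nn s by (intro powr_mono2) (auto intro: sum_nonneg)
  also have "\<dots> = real (card B) powr s * x b powr s"
    using nn[OF b(1)] b(2) by (simp add: powr_mult)
  also have "\<dots> \<le> real (card B) powr s * (\<Sum>b\<in>B. x b powr s)"
    using b(1) \<open>finite B\<close> by (intro mult_left_mono member_le_sum) auto
  finally show ?thesis .
qed simp

corollary powr_add_le:
  fixes x y :: real
  assumes "0 \<le> x" "0 \<le> y" "0 \<le> s"
  shows "(x + y) powr s \<le> 2 powr s * (x powr s + y powr s)"
  using powr_sum_le[of UNIV "\<lambda>b. if b then x else y" s] assms
  by (simp add: UNIV_bool add.commute)

text \<open>
  The properties that survive of the \<open>s\<close>-th power of a norm dominating the Euclidean one. The triangle
  inequality carries the factor \<open>2\<^sup>s\<close>, which treats \<open>s < 1\<close> and \<open>s \<ge> 1\<close> alike.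
\<close>
definition powr_gauge :: "real \<Rightarrow> ('a::real_inner \<Rightarrow> real) \<Rightarrow> bool"
  where "powr_gauge s f \<longleftrightarrow>
    (\<forall>v. norm v powr s \<le> f v) \<and>
    (\<forall>c v. f (c *\<^sub>R v) = \<bar>c\<bar> powr s * f v) \<and>
    (\<forall>u v. f (u + v) \<le> 2 powr s * (f u + f v))"

text \<open>
  On the unit sphere \<open>f\<close> is bounded below by 1, so its infimum is positive and a point within a factor
  of 2 of it exists.
\<close>
lemma powr_gauge_near_minimiser:
  fixes f :: "'a::euclidean_space \<Rightarrow> real"
  assumes f: "powr_gauge s f" and W: "subspace W" "dim W \<noteq> 0" and s: "0 \<le> s"
  obtains e where "e \<in> W" "norm e = 1" "\<And>v. v \<in> W \<Longrightarrow> f e * norm v powr s \<le> 2 * f v"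
proof -
  have lo: "norm v powr s \<le> f v" and hom: "f (c *\<^sub>R v) = \<bar>c\<bar> powr s * f v" for c v
    using f by (auto simp: powr_gauge_def)
  have nn: "0 \<le> f v" for v
    using lo[of v] powr_ge_zero[of "norm v" s] by linarith
  define U where "U = {u \<in> W. norm u = 1}"
  obtain w where w: "w \<in> W" "w \<noteq> 0"
    using W(2) by (metis dim_eq_0 singletonI subsetI)
  have "w /\<^sub>R norm w \<in> U"
    using w W(1) by (auto simp: U_def subspace_scale)
  then have ne: "U \<noteq> {}" by auto
  have bdd: "bdd_below (f ` U)"
    using nn by (intro bdd_belowI2[of _ 0]) auto
  have f1: "1 \<le> f u" if "u \<in> U" for u
    using lo[of u] that by (auto simp: U_def)
  have inf1: "1 \<le> Inf (f ` U)"
    using ne f1 by (intro cInf_greatest) auto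
  then have "Inf (f ` U) < 2 * Inf (f ` U)" by linarith
  then obtain e where e: "e \<in> U" "f e < 2 * Inf (f ` U)"
    using cInf_less_iff[OF _ bdd] ne by auto
  have "f e * norm v powr s \<le> 2 * f v" if "v \<in> W" for v
  proof (cases "v = 0")
    case True
    then show ?thesis using nn[of v] by simp
  next
    case False
    have "v /\<^sub>R norm v \<in> U"
      using False that W(1) by (auto simp: U_def subspace_scale)
    then have "Inf (f ` U) \<le> f (v /\<^sub>R norm v)"
      using bdd by (intro cInf_lower) auto
    then have "f e \<le> 2 * f (v /\<^sub>R norm v)"
      using e(2) by linarith
    then have "f e * norm v powr s \<le> 2 * f (v /\<^sub>R norm v) * norm v powr s"
      by (intro mult_right_mono) auto
    also have "\<dots> = 2 * f (norm v *\<^sub>R (v /\<^sub>R norm v))"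
      by (simp only: hom) simp
    finally show ?thesis using False by simp
  qed
  with e(1) show thesis by (intro that[of e]) (auto simp: U_def)
qed

text \<open>
  The basis is built greedily: \<open>e\<close> is a near-minimiser of \<open>f\<close> on the unit sphere of \<open>W\<close>, and the
  construction continues in the orthogonal complement of \<open>e\<close> in \<open>W\<close>. Minimisers are
  taken, not maximisers, because for \<open>s < 1\<close> the function \<open>f\<close> is far from convex: a bound below for the
  component along a maximiser would need a supporting functional, whereas near-minimality bounds the component of \<open>v\<close>
  along \<open>e\<close> by \<open>f e |v \<bullet> e|\<^sup>s \<le> 2 f v\<close>, hence the remainder \<open>u = v - (v \<bullet> e) e\<close> satisfies
  \<open>f u \<le> 2\<^sup>s (f v + 2 f v)\<close>. So each dimension costs a factor \<open>3 \<cdot> 2\<^sup>s\<close>.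
\<close>
lemma powr_gauge_orthonormal_basis:
  fixes f :: "'a::euclidean_space \<Rightarrow> real"
  assumes f: "powr_gauge s f" and s: "0 \<le> s" and W: "subspace W"
  shows "\<exists>B. finite B \<and> card B = dim W \<and> B \<subseteq> W \<and> pairwise orthogonal B \<and> (\<forall>e\<in>B. norm e = 1) \<and>
    (\<forall>v\<in>W. (\<Sum>e\<in>B. (v \<bullet> e) *\<^sub>R e) = v) \<and>
    (\<forall>v\<in>W. \<forall>e\<in>B. f e * \<bar>v \<bullet> e\<bar> powr s \<le> (3 * 2 powr s) ^ dim W * f v)"
  using W
proof (induction "dim W" arbitrary: W)
  case 0
  then have "W \<subseteq> {0}" by simp
  then show ?case using 0 by (intro exI[of _ "{}"]) auto
next
  case (Suc k)
  have lo: "norm v powr s \<le> f v" and hom: "f (c *\<^sub>R v) = \<bar>c\<bar> powr s * f v"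
    and tri: "f (u + v) \<le> 2 powr s * (f u + f v)" for c u v
    using f by (auto simp: powr_gauge_def)
  have nn: "0 \<le> f v" for v
    using lo[of v] powr_ge_zero[of "norm v" s] by linarith
  have two: "(1::real) \<le> 2 powr s" using s by (simp add: ge_one_powr_ge_zero)
  define \<kappa> :: real where "\<kappa> = 3 * 2 powr s"
  have \<kappa>: "2 \<le> \<kappa>" "3 * 2 powr s = \<kappa>" using two by (auto simp: \<kappa>_def)
  obtain e where e: "e \<in> W" "norm e = 1" and min: "\<And>v. v \<in> W \<Longrightarrow> f e * norm v powr s \<le> 2 * f v"
    using powr_gauge_near_minimiser[OF f \<open>subspace W\<close> _ s] Suc.hyps(2) by (metis nat.distinct(1))
  have ee: "e \<bullet> e = 1" using e(2) by (simp add: dot_square_norm)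
  have along: "f e * \<bar>v \<bullet> e\<bar> powr s \<le> 2 * f v" if "v \<in> W" for v
  proof -
    have "\<bar>v \<bullet> e\<bar> \<le> norm v" using Cauchy_Schwarz_ineq2[of v e] e(2) by simp
    then have "f e * \<bar>v \<bullet> e\<bar> powr s \<le> f e * norm v powr s"
      using nn s by (intro mult_left_mono powr_mono2) auto
    with min[OF that] show ?thesis by linarith
  qed
  define W' where "W' = {y \<in> W. \<forall>x\<in>span {e}. orthogonal x y}"
  have "dim W' + dim (span {e}) = dim W"
    unfolding W'_def using e(1) Suc.prems
    by (intro dim_subspace_orthogonal_to_vectors) (auto simp: span_minimal)
  moreover have "dim (span {e}) = 1"
    using e(2) by (simp add: dim_span) (metis dim_singleton norm_zero zero_neq_one)
  ultimately have dimW': "k = dim W'" using Suc.hyps(2) by simp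
  have W'_eq: "W' = {y \<in> W. e \<bullet> y = 0}"
    unfolding W'_def by (auto simp: orthogonal_def span_singleton)
  have "subspace W'"
    using Suc.prems unfolding W'_eq by (auto simp: subspace_def inner_right_distrib)
  from Suc.hyps(1)[OF dimW' this] obtain B where
    B: "finite B" "card B = dim W'" "B \<subseteq> W'" "pairwise orthogonal B" "\<forall>b\<in>B. norm b = 1"
      and expand: "\<forall>v\<in>W'. (\<Sum>b\<in>B. (v \<bullet> b) *\<^sub>R b) = v"
      and low: "\<forall>v\<in>W'. \<forall>b\<in>B. f b * \<bar>v \<bullet> b\<bar> powr s \<le> \<kappa> ^ k * f v"
    unfolding \<kappa>(2) using dimW' by blast
  have eB: "e \<bullet> b = 0" if "b \<in> B" for b using that B(3) W'_eq by auto
  then have "e \<notin> B" using ee by force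
  have rest: "v - (v \<bullet> e) *\<^sub>R e \<in> W'" if "v \<in> W" for v
    using that e(1) ee Suc.prems unfolding W'_eq
    by (auto simp: subspace_diff subspace_scale inner_diff_right inner_commute)
  have inner_rest: "(v - (v \<bullet> e) *\<^sub>R e) \<bullet> b = v \<bullet> b" if "b \<in> B" for v b
    using eB[OF that] by (simp add: inner_diff_left)
  have "(\<Sum>b\<in>insert e B. (v \<bullet> b) *\<^sub>R b) = v" if "v \<in> W" for v
  proof -
    have "(\<Sum>b\<in>B. (v \<bullet> b) *\<^sub>R b) = v - (v \<bullet> e) *\<^sub>R e"
      using expand rest[OF that] inner_rest by (metis (no_types, lifting) sum.cong)
    then show ?thesis using B(1) \<open>e \<notin> B\<close> by simp
  qed
  moreover have "f b * \<bar>v \<bullet> b\<bar> powr s \<le> \<kappa> ^ Suc k * f v" if "v \<in> W" "b \<in> insert e B" for v b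
  proof (cases "b = e")
    case True
    have "2 * f v \<le> \<kappa> ^ Suc k * f v"
      using \<kappa>(1) nn one_le_power[of \<kappa> k] mult_mono[of 2 \<kappa> 1 "\<kappa> ^ k"]
      by (intro mult_right_mono) auto
    with along[OF that(1)] show ?thesis unfolding True by linarith
  next
    case False
    then have b: "b \<in> B" using that by auto
    define u where "u = v - (v \<bullet> e) *\<^sub>R e"
    have "f u = f (v + (- (v \<bullet> e)) *\<^sub>R e)" by (simp add: u_def)
    also have "\<dots> \<le> 2 powr s * (f v + \<bar>v \<bullet> e\<bar> powr s * f e)"
      using tri[of v "(- (v \<bullet> e)) *\<^sub>R e"] by (simp only: hom abs_minus_cancel)
    also have "\<dots> \<le> 2 powr s * (f v + 2 * f v)"
      using along[OF that(1)] by (intro mult_left_mono add_left_mono) (auto simp: mult.commute)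
    finally have "f u \<le> \<kappa> * f v" by (simp add: \<kappa>_def)
    have "f b * \<bar>v \<bullet> b\<bar> powr s = f b * \<bar>u \<bullet> b\<bar> powr s"
      using inner_rest[OF b] by (simp add: u_def)
    also have "\<dots> \<le> \<kappa> ^ k * f u"
      using low rest[OF that(1)] b by (auto simp: u_def)
    also have "\<dots> \<le> \<kappa> ^ k * (\<kappa> * f v)"
      using \<open>f u \<le> \<kappa> * f v\<close> \<kappa>(1) by (intro mult_left_mono) auto
    finally show ?thesis by (simp add: mult_ac)
  qed
  moreover have "pairwise orthogonal (insert e B)"
    using B(4) eB by (auto simp: pairwise_insert orthogonal_def inner_commute)
  moreover have "insert e B \<subseteq> W" using B(3) e(1) W'_eq by auto
  moreover have "card (insert e B) = dim W"
    using B(1,2) \<open>e \<notin> B\<close> Suc.hyps(2) dimW' by simp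
  ultimately show ?case
    using B(1,5) e(2) Suc.hyps(2) unfolding \<kappa>(2)
    by (intro exI[of _ "insert e B"]) (auto simp del: power_Suc)
qed

section \<open>Sums over words\<close>

lemma finite_words [simp]: "finite {w :: 'm::finite list. length w = n}"
  using finite_lists_length_eq[of "UNIV :: 'm set" n] by simp

lemma sum_words_append:
  fixes g :: "'m::finite list \<Rightarrow> 'b::comm_monoid_add"
  shows "(\<Sum>w | length w = a + b. g w) = (\<Sum>u | length u = a. \<Sum>v | length v = b. g (u @ v))"
  unfolding sum.cartesian_product
  by (rule sum.reindex_bij_witness
        [of _ "\<lambda>(u, v). u @ v" "\<lambda>w. (take a w, drop a w)"]) auto

lemma word_prod_append: "word_prod A (u @ v) = word_prod A v ** word_prod A u"
proof -
  have "fold (\<lambda>i P. (A $ i) ** P) v Q = fold (\<lambda>i P. (A $ i) ** P) v (mat 1) ** Q" for Q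
  proof (induction v rule: rev_induct)
    case (snoc i v)
    then show ?case by (simp add: matrix_mul_assoc)
  qed simp
  then show ?thesis by (simp add: word_prod_def)
qed

lemma word_prod_append_apply: "word_prod A (u @ v) *v x = word_prod A v *v (word_prod A u *v x)"
  by (simp add: word_prod_append matrix_vector_mul_assoc)

lemma norm_matrix_apply_le: "norm (B *v x) \<le> op_norm B * norm x"
  unfolding op_norm_def by (intro onorm) simp

lemma op_norm_nonneg [simp]: "0 \<le> op_norm B"
  unfolding op_norm_def by (intro onorm_pos_le) simp

lemma op_norm_mult_le: "op_norm (B ** C) \<le> op_norm B * op_norm C"
  using onorm_compose[of "(*v) B" "(*v) C"]
  by (simp add: op_norm_def o_def matrix_vector_mul_assoc)

lemma norm_sum_nonneg: "0 \<le> norm_sum A s n"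
  unfolding norm_sum_def by (intro sum_nonneg) auto

lemma norm_sum_add_le:
  fixes A :: "real^'d^'d^'m"
  assumes "0 \<le> s"
  shows "norm_sum A s (a + b) \<le> norm_sum A s a * norm_sum A s b"
proof -
  have "norm_sum A s (a + b) \<le>
    (\<Sum>u | length u = a. \<Sum>v | length v = b. op_norm (word_prod A u) powr s * op_norm (word_prod A v) powr s)"
    unfolding norm_sum_def sum_words_append
  proof (intro sum_mono)
    fix u v :: "'m list"
    have "op_norm (word_prod A (u @ v)) powr s \<le> (op_norm (word_prod A u) * op_norm (word_prod A v)) powr s"
      using op_norm_mult_le[of "word_prod A v" "word_prod A u"] assms
      by (intro powr_mono2) (auto simp: word_prod_append mult.commute)
    then show "op_norm (word_prod A (u @ v)) powr s
      \<le> op_norm (word_prod A u) powr s * op_norm (word_prod A v) powr s"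
      by (simp add: powr_mult)
  qed
  then show ?thesis unfolding norm_sum_def by (simp add: sum_product)
qed

definition orbit_sum :: "real^'d^'d^'m \<Rightarrow> real \<Rightarrow> nat \<Rightarrow> real^'d \<Rightarrow> real"
  where "orbit_sum A s k v = (\<Sum>w | length w = k. norm (word_prod A w *v v) powr s)"

lemma orbit_sum_0 [simp]: "orbit_sum A s 0 v = norm v powr s"
  by (simp add: orbit_sum_def word_prod_def)

lemma orbit_sum_nonneg: "0 \<le> orbit_sum A s k v"
  unfolding orbit_sum_def by (intro sum_nonneg) auto

lemma orbit_sum_add: "orbit_sum A s (a + b) v = (\<Sum>w | length w = a. orbit_sum A s b (word_prod A w *v v))"
  by (simp add: orbit_sum_def sum_words_append word_prod_append_apply)

lemma orbit_sum_le:
  assumes "0 \<le> s"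
  shows "orbit_sum A s k v \<le> norm_sum A s k * norm v powr s"
  unfolding orbit_sum_def norm_sum_def sum_distrib_right
  using assms by (intro sum_mono) (auto simp flip: powr_mult intro!: powr_mono2 norm_matrix_apply_le)

lemma orbit_sum_scaleR: "orbit_sum A s k (c *\<^sub>R v) = \<bar>c\<bar> powr s * orbit_sum A s k v"
  by (simp add: orbit_sum_def matrix_vector_mult_scaleR powr_mult sum_distrib_left)

lemma orbit_sum_add_le:
  fixes A :: "real^'d^'d^'m"
  assumes "0 \<le> s"
  shows "orbit_sum A s k (u + v) \<le> 2 powr s * (orbit_sum A s k u + orbit_sum A s k v)"
  unfolding orbit_sum_def sum.distrib[symmetric] sum_distrib_left
proof (intro sum_mono)
  fix w :: "'m list"
  have "norm (word_prod A w *v (u + v)) powr s \<le> (norm (word_prod A w *v u) + norm (word_prod A w *v v)) powr s"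
    using assms by (intro powr_mono2) (auto simp: matrix_vector_right_distrib norm_triangle_ineq)
  also have "\<dots> \<le> 2 powr s * (norm (word_prod A w *v u) powr s + norm (word_prod A w *v v) powr s)"
    using assms by (intro powr_add_le) auto
  finally show "norm (word_prod A w *v (u + v)) powr s \<le> \<dots>" .
qed

section \<open>A gauge contracted at a prescribed rate\<close>

text \<open>
  With \<open>F\<^sub>k v\<close> the sum of \<open>\<parallel>A\<^sub>w v\<parallel>\<^sup>s\<close> over \<open>|w| = k\<close>, take \<open>f = \<Sum>\<^sub>k\<^sub><\<^sub>N F\<^sub>k / q\<^sup>k\<close>. Applying all letters
  shifts the sum by one index and multiplies it by \<open>q\<close>. The shift loses the term \<open>F\<^sub>0 v = \<parallel>v\<parallel>\<^sup>s\<close> and gains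
  \<open>F\<^sub>N v / q\<^sup>N\<close>, which is no larger because \<open>P\<^sub>N \<le> q\<^sup>N\<close>.
\<close>
lemma exists_contracted_powr_gauge:
  fixes A :: "real^'d^'d^'m"
  assumes s: "0 \<le> s" and N: "0 < N" and q: "0 < q" and qN: "norm_sum A s N \<le> q ^ N"
  obtains f where "powr_gauge s f"
    "\<And>n v. (\<Sum>w | length w = n. f (word_prod A w *v v)) \<le> q ^ n * f v"
proof -
  define f where "f v = (\<Sum>k<N. orbit_sum A s k v / q ^ k)" for v
  have "norm v powr s \<le> f v" for v
    using member_le_sum[of 0 "{..<N}" "\<lambda>k. orbit_sum A s k v / q ^ k"] N q
      orbit_sum_nonneg[of A s _ v]
    by (simp add: f_def)
  moreover have "f (c *\<^sub>R v) = \<bar>c\<bar> powr s * f v" for c v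
    by (simp add: f_def orbit_sum_scaleR sum_distrib_left)
  moreover have "f (u + v) \<le> 2 powr s * (f u + f v)" for u v
  proof -
    have "f (u + v) \<le> (\<Sum>k<N. 2 powr s * (orbit_sum A s k u + orbit_sum A s k v) / q ^ k)"
      unfolding f_def using s q by (intro sum_mono divide_right_mono orbit_sum_add_le) auto
    also have "\<dots> = 2 powr s * (f u + f v)"
      by (simp add: f_def sum_distrib_left flip: sum.distrib) (simp add: add_divide_distrib distrib_left)
    finally show ?thesis .
  qed
  ultimately have gauge: "powr_gauge s f" unfolding powr_gauge_def by blast
  have step: "(\<Sum>w | length w = 1. f (word_prod A w *v v)) \<le> q * f v" for v
  proof -
    define g where "g k = orbit_sum A s k v / q ^ k" for k
    have "(\<Sum>w | length w = 1. f (word_prod A w *v v))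
        = (\<Sum>k<N. (\<Sum>w | length w = 1. orbit_sum A s k (word_prod A w *v v)) / q ^ k)"
      unfolding f_def by (subst sum.swap) (simp add: sum_divide_distrib)
    also have "\<dots> = (\<Sum>k<N. q * g (Suc k))"
      using q by (intro sum.cong) (auto simp: g_def orbit_sum_add[of A s 1, symmetric, simplified])
    also have "\<dots> = q * (\<Sum>k<N. g (Suc k))" by (simp add: sum_distrib_left)
    also have "(\<Sum>k<N. g (Suc k)) = f v + g N - g 0"
      using sum.lessThan_Suc_shift[of g N] by (simp add: f_def g_def)
    also have "g N \<le> g 0"
    proof -
      have "orbit_sum A s N v \<le> q ^ N * norm v powr s"
        using orbit_sum_le[OF s, of A N v] mult_right_mono[OF qN, of "norm v powr s"] by simp
      then show ?thesis using q by (simp add: g_def field_simps)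
    qed
    finally show ?thesis using q by simp
  qed
  have "(\<Sum>w | length w = n. f (word_prod A w *v v)) \<le> q ^ n * f v" for n v
  proof (induction n)
    case 0
    then show ?case by (simp add: word_prod_def)
  next
    case (Suc n)
    have "(\<Sum>w | length w = Suc n. f (word_prod A w *v v))
        = (\<Sum>u | length u = n. \<Sum>w | length w = 1. f (word_prod A w *v (word_prod A u *v v)))"
      using sum_words_append[of "\<lambda>w. f (word_prod A w *v v)" n 1]
      by (simp add: word_prod_append_apply)
    also have "\<dots> \<le> (\<Sum>u | length u = n. q * f (word_prod A u *v v))"
      by (intro sum_mono step)
    also have "\<dots> = q * (\<Sum>u | length u = n. f (word_prod A u *v v))"
      by (simp add: sum_distrib_left)
    also have "\<dots> \<le> q * (q ^ n * f v)"
      using Suc q by (intro mult_left_mono) auto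
    finally show ?case by simp
  qed
  with gauge show thesis by (rule that)
qed

section \<open>Matrix entries of long products\<close>

definition entry_sum :: "real^'d^'d^'m \<Rightarrow> real \<Rightarrow> nat \<Rightarrow> real^'d \<Rightarrow> real^'d \<Rightarrow> real"
  where "entry_sum A s k e e' = (\<Sum>w | length w = k. \<bar>(word_prod A w *v e) \<bullet> e'\<bar> powr s)"

lemma entry_sum_nonneg: "0 \<le> entry_sum A s k e e'"
  unfolding entry_sum_def by (intro sum_nonneg) auto

lemma entry_sum_0_orthogonal: "e \<bullet> e' = 0 \<Longrightarrow> entry_sum A s 0 e e' = 0"
  by (simp add: entry_sum_def word_prod_def)

lemma entry_sum_0_le_1:
  assumes "norm e = 1" "norm e' = 1" "0 \<le> s"
  shows "entry_sum A s 0 e e' \<le> 1"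
  using assms Cauchy_Schwarz_ineq2[of e e'] powr_mono2[of s "\<bar>e \<bullet> e'\<bar>" 1]
  by (simp add: entry_sum_def word_prod_def)

lemma entry_sum_le_norm_sum:
  assumes "norm e = 1" "norm e' = 1" "0 \<le> s"
  shows "entry_sum A s k e e' \<le> norm_sum A s k"
  unfolding entry_sum_def norm_sum_def
proof (intro sum_mono powr_mono2)
  fix w
  show "\<bar>(word_prod A w *v e) \<bullet> e'\<bar> \<le> op_norm (word_prod A w)"
    using Cauchy_Schwarz_ineq2[of "word_prod A w *v e" e'] norm_matrix_apply_le[of "word_prod A w" e] assms
    by simp
qed (use assms in auto)

lemma entry_sum_add_le:
  fixes A :: "real^'d^'d^'m"
  assumes B: "finite B" "\<And>v. (\<Sum>e\<in>B. (v \<bullet> e) *\<^sub>R e) = v" and s: "0 \<le> s"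
  shows "entry_sum A s (a + b) x y
    \<le> real (card B) powr s * (\<Sum>e\<in>B. entry_sum A s a x e * entry_sum A s b e y)"
proof -
  let ?T = "word_prod A"
  have pt: "\<bar>(?T (u @ v) *v x) \<bullet> y\<bar> powr s
      \<le> real (card B) powr s * (\<Sum>e\<in>B. \<bar>(?T u *v x) \<bullet> e\<bar> powr s * \<bar>(?T v *v e) \<bullet> y\<bar> powr s)" for u v
  proof -
    have "?T (u @ v) *v x = ?T v *v (\<Sum>e\<in>B. ((?T u *v x) \<bullet> e) *\<^sub>R e)"
      by (simp add: B(2) word_prod_append_apply)
    also have "\<dots> = (\<Sum>e\<in>B. ((?T u *v x) \<bullet> e) *\<^sub>R (?T v *v e))"
      by (simp add: linear_sum[OF matrix_vector_mul_linear] matrix_vector_mult_scaleR)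
    finally have "\<bar>(?T (u @ v) *v x) \<bullet> y\<bar> = \<bar>\<Sum>e\<in>B. ((?T u *v x) \<bullet> e) * ((?T v *v e) \<bullet> y)\<bar>"
      by (simp add: inner_sum_left)
    also have "\<dots> \<le> (\<Sum>e\<in>B. \<bar>(?T u *v x) \<bullet> e\<bar> * \<bar>(?T v *v e) \<bullet> y\<bar>)"
      using sum_abs[of "\<lambda>e. ((?T u *v x) \<bullet> e) * ((?T v *v e) \<bullet> y)" B] by (simp add: abs_mult)
    finally have "\<bar>(?T (u @ v) *v x) \<bullet> y\<bar> powr s \<le> \<dots> powr s"
      using s by (intro powr_mono2) auto
    also have "\<dots> \<le> real (card B) powr s * (\<Sum>e\<in>B. (\<bar>(?T u *v x) \<bullet> e\<bar> * \<bar>(?T v *v e) \<bullet> y\<bar>) powr s)"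
      using B(1) s by (intro powr_sum_le) auto
    finally show ?thesis by (simp add: powr_mult)
  qed
  have "entry_sum A s (a + b) x y \<le> (\<Sum>u | length u = a. \<Sum>v | length v = b.
      real (card B) powr s * (\<Sum>e\<in>B. \<bar>(?T u *v x) \<bullet> e\<bar> powr s * \<bar>(?T v *v e) \<bullet> y\<bar> powr s))"
    unfolding entry_sum_def sum_words_append by (intro sum_mono pt)
  also have "\<dots> = real (card B) powr s * (\<Sum>u | length u = a. \<Sum>v | length v = b. \<Sum>e\<in>B.
      \<bar>(?T u *v x) \<bullet> e\<bar> powr s * \<bar>(?T v *v e) \<bullet> y\<bar> powr s)"
    by (simp add: sum_distrib_left)
  also have "(\<Sum>u | length u = a. \<Sum>v | length v = b. \<Sum>e\<in>B.
      \<bar>(?T u *v x) \<bullet> e\<bar> powr s * \<bar>(?T v *v e) \<bullet> y\<bar> powr s)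
    = (\<Sum>u | length u = a. \<Sum>e\<in>B. \<Sum>v | length v = b.
      \<bar>(?T u *v x) \<bullet> e\<bar> powr s * \<bar>(?T v *v e) \<bullet> y\<bar> powr s)"
    by (intro sum.cong refl sum.swap)
  also have "\<dots> = (\<Sum>e\<in>B. \<Sum>u | length u = a. \<Sum>v | length v = b.
      \<bar>(?T u *v x) \<bullet> e\<bar> powr s * \<bar>(?T v *v e) \<bullet> y\<bar> powr s)"
    by (rule sum.swap)
  also have "\<dots> = (\<Sum>e\<in>B. entry_sum A s a x e * entry_sum A s b e y)"
    by (simp add: entry_sum_def sum_product)
  finally show ?thesis .
qed

lemma op_norm_le_sum_entries:
  fixes T :: "real^'d^'d"
  assumes B: "\<And>e. e \<in> B \<Longrightarrow> norm e = 1" "\<And>v. (\<Sum>e\<in>B. (v \<bullet> e) *\<^sub>R e) = v"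
  shows "op_norm T \<le> (\<Sum>e\<in>B. \<Sum>e'\<in>B. \<bar>(T *v e) \<bullet> e'\<bar>)"
  unfolding op_norm_def
proof (rule onorm_le)
  fix v
  have norm_le: "norm u \<le> (\<Sum>e\<in>B. \<bar>u \<bullet> e\<bar>)" for u
    using norm_sum[of "\<lambda>e. (u \<bullet> e) *\<^sub>R e" B] B by simp
  have "T *v v = T *v (\<Sum>e\<in>B. (v \<bullet> e) *\<^sub>R e)" by (simp add: B(2))
  also have "\<dots> = (\<Sum>e\<in>B. (v \<bullet> e) *\<^sub>R (T *v e))"
    by (simp add: linear_sum[OF matrix_vector_mul_linear] matrix_vector_mult_scaleR)
  finally have "norm (T *v v) \<le> (\<Sum>e\<in>B. \<bar>v \<bullet> e\<bar> * norm (T *v e))"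
    using norm_sum[of "\<lambda>e. (v \<bullet> e) *\<^sub>R (T *v e)" B] by simp
  also have "\<dots> \<le> (\<Sum>e\<in>B. norm v * (\<Sum>e'\<in>B. \<bar>(T *v e) \<bullet> e'\<bar>))"
  proof (intro sum_mono mult_mono norm_le)
    fix e assume "e \<in> B"
    then show "\<bar>v \<bullet> e\<bar> \<le> norm v" using Cauchy_Schwarz_ineq2[of v e] B(1) by simp
  qed auto
  finally show "norm (T *v v) \<le> (\<Sum>e\<in>B. \<Sum>e'\<in>B. \<bar>(T *v e) \<bullet> e'\<bar>) * norm v"
    by (simp add: sum_distrib_left mult.commute)
qed

lemma norm_sum_le_entry_sum:
  fixes A :: "real^'d^'d^'m"
  assumes B: "finite B" "\<And>e. e \<in> B \<Longrightarrow> norm e = 1" "\<And>v. (\<Sum>e\<in>B. (v \<bullet> e) *\<^sub>R e) = v"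
    and s: "0 \<le> s"
  shows "norm_sum A s k \<le> real (card (B \<times> B)) powr s * (\<Sum>(e, e')\<in>B \<times> B. entry_sum A s k e e')"
proof -
  have "op_norm (word_prod A w) powr s
      \<le> real (card (B \<times> B)) powr s * (\<Sum>(e, e')\<in>B \<times> B. \<bar>(word_prod A w *v e) \<bullet> e'\<bar> powr s)" for w
  proof -
    have "op_norm (word_prod A w) \<le> (\<Sum>p\<in>B \<times> B. \<bar>(word_prod A w *v fst p) \<bullet> snd p\<bar>)"
      using op_norm_le_sum_entries[OF B(2,3)] by (simp add: sum.cartesian_product case_prod_unfold)
    then have "op_norm (word_prod A w) powr s \<le> \<dots> powr s"
      using s by (intro powr_mono2) auto
    also have "\<dots> \<le> real (card (B \<times> B)) powr s * (\<Sum>p\<in>B \<times> B. \<bar>(word_prod A w *v fst p) \<bullet> snd p\<bar> powr s)"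
      using B(1) s by (intro powr_sum_le) auto
    finally show ?thesis by (simp add: case_prod_unfold)
  qed
  then have "norm_sum A s k \<le> (\<Sum>w | length w = k. real (card (B \<times> B)) powr s *
      (\<Sum>(e, e')\<in>B \<times> B. \<bar>(word_prod A w *v e) \<bullet> e'\<bar> powr s))"
    unfolding norm_sum_def by (intro sum_mono)
  also have "\<dots> = real (card (B \<times> B)) powr s *
      (\<Sum>w | length w = k. \<Sum>(e, e')\<in>B \<times> B. \<bar>(word_prod A w *v e) \<bullet> e'\<bar> powr s)"
    by (simp add: sum_distrib_left)
  also have "(\<Sum>w | length w = k. \<Sum>(e, e')\<in>B \<times> B. \<bar>(word_prod A w *v e) \<bullet> e'\<bar> powr s)
      = (\<Sum>(e, e')\<in>B \<times> B. entry_sum A s k e e')"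
    by (subst sum.swap) (simp add: entry_sum_def case_prod_unfold)
  finally show ?thesis .
qed

text \<open>
  In an expansion over paths from \<open>e\<close> to \<open>e'\<close> in \<open>B\<close>, each step costs at most \<open>P\<close>, and a step along which
  \<open>h\<close> does not decrease costs at most \<open>X\<close>. The rank \<open>r\<close> counts the elements of \<open>B\<close> on which \<open>h\<close> is
  smaller, and it drops at every step along which \<open>h\<close> decreases. If \<open>r e < r e' + k\<close>, then \<open>k\<close> strict
  drops cannot lead from \<open>e\<close> to \<open>e'\<close>, so one factor \<open>P\<close> can be traded for \<open>X\<close>. The trade is expressed by a
  factor \<open>P\<close> on the left, so that the induction can start at \<open>k = 0\<close>, where \<open>e \<noteq> e'\<close> are orthogonal
  and the entry vanishes. The factor \<open>D\<close> per step accounts for the number of paths and for taking the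
  power \<open>s\<close> of a sum.
\<close>
lemma entry_sum_block_bound:
  fixes A :: "real^'d^'d^'m" and h :: "real^'d \<Rightarrow> real" and B n s
  defines "P \<equiv> norm_sum A s n" and "D \<equiv> real (card B) powr s * real (card B)"
    and "r \<equiv> \<lambda>e. card {b \<in> B. h b < h e}"
  assumes B: "finite B" "pairwise orthogonal B" "\<And>e. e \<in> B \<Longrightarrow> norm e = 1"
      "\<And>v. (\<Sum>e\<in>B. (v \<bullet> e) *\<^sub>R e) = v"
    and s: "0 \<le> s" and X: "0 \<le> X"
    and up: "\<And>e e'. e \<in> B \<Longrightarrow> e' \<in> B \<Longrightarrow> h e \<le> h e' \<Longrightarrow> entry_sum A s n e e' \<le> X"
    and e: "e \<in> B" "e' \<in> B"
    and rank: "r e < r e' + k"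
  shows "entry_sum A s (k * n) e e' * P \<le> D ^ k * (X * P ^ k)"
proof -
  have P: "0 \<le> P" by (simp add: P_def norm_sum_nonneg)
  have D: "0 \<le> D" by (simp add: D_def)
  have step: "entry_sum A s (Suc k * n) e e' * c \<le> D * Y"
    if c: "0 \<le> c" and le: "\<And>b. b \<in> B \<Longrightarrow> entry_sum A s (k * n) e b * entry_sum A s n b e' * c \<le> Y" for k e' c Y
  proof -
    have "entry_sum A s (Suc k * n) e e' * c
        \<le> (real (card B) powr s * (\<Sum>b\<in>B. entry_sum A s (k * n) e b * entry_sum A s n b e')) * c"
      using entry_sum_add_le[OF B(1,4) s, of A "k * n" n e e'] c
      by (intro mult_right_mono) (simp_all add: add.commute)
    also have "\<dots> = real (card B) powr s * (\<Sum>b\<in>B. entry_sum A s (k * n) e b * entry_sum A s n b e' * c)"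
      by (simp add: sum_distrib_right mult.assoc)
    also have "\<dots> \<le> real (card B) powr s * (real (card B) * Y)"
      using le by (intro mult_left_mono sum_bounded_above) auto
    finally show ?thesis by (simp add: D_def mult.assoc)
  qed
  have one: "entry_sum A s n b b' \<le> P" if "b \<in> B" "b' \<in> B" for b b'
    unfolding P_def using that B(3) s by (intro entry_sum_le_norm_sum) auto
  have first: "entry_sum A s (k * n) e e' \<le> D ^ k * P ^ k" if "e' \<in> B" for k e'
    using that
  proof (induction k arbitrary: e')
    case 0
    then show ?case using entry_sum_0_le_1[of e e' s A] B(3) e(1) s by simp
  next
    case (Suc k)
    have "entry_sum A s (Suc k * n) e e' * 1 \<le> D * (D ^ k * P ^ k * P)"
    proof (rule step)
      fix b assume "b \<in> B"
      then have "entry_sum A s (k * n) e b * entry_sum A s n b e' \<le> (D ^ k * P ^ k) * P"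
        using Suc.IH one Suc.prems P D by (intro mult_mono) (auto simp: entry_sum_nonneg)
      then show "entry_sum A s (k * n) e b * entry_sum A s n b e' * 1 \<le> D ^ k * P ^ k * P" by simp
    qed simp
    then show ?case by (simp add: mult_ac)
  qed
  have r_le: "h b \<le> h b'" if "r b \<le> r b'" "b' \<in> B" for b b'
  proof (rule ccontr)
    assume "\<not> h b \<le> h b'"
    then have "{c \<in> B. h c < h b'} \<subset> {c \<in> B. h c < h b}" using that(2) by force
    then have "r b' < r b" unfolding r_def using B(1) by (intro psubset_card_mono) auto
    with that(1) show False by simp
  qed
  have second: "entry_sum A s (k * n) e e' * P \<le> D ^ k * (X * P ^ k)"
    if "e' \<in> B" "r e < r e' + k" for k e'
    using that
  proof (induction k arbitrary: e')
    case 0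
    then have "e \<noteq> e'" by auto
    then have "e \<bullet> e' = 0" using B(2) e(1) 0 by (auto simp: pairwise_def orthogonal_def)
    then show ?case using X by (simp add: entry_sum_0_orthogonal)
  next
    case (Suc k)
    have "entry_sum A s (Suc k * n) e e' * P \<le> D * (D ^ k * X * P ^ k * P)"
    proof (rule step)
      fix b assume b: "b \<in> B"
      show "entry_sum A s (k * n) e b * entry_sum A s n b e' * P \<le> D ^ k * X * P ^ k * P"
      \<comment> \<open>Either the trade has already happened on the way to \<open>b\<close>, or it happens in the step from \<open>b\<close> to \<open>e'\<close>.\<close>
      proof (cases "r e < r b + k")
        case True
        have "(entry_sum A s (k * n) e b * P) * entry_sum A s n b e' \<le> (D ^ k * (X * P ^ k)) * P"
          using P D X
          by (intro mult_mono[OF Suc.IH[OF b True] one[OF b Suc.prems(1)]]) (auto simp: entry_sum_nonneg)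
        then show ?thesis by (simp add: mult_ac)
      next
        case False
        with Suc.prems(2) have "r b \<le> r e'" by linarith
        then have "entry_sum A s n b e' \<le> X" using up b Suc.prems(1) r_le by blast
        then have "(entry_sum A s (k * n) e b * entry_sum A s n b e') * P \<le> ((D ^ k * P ^ k) * X) * P"
          using first[OF b, of k] P D by (intro mult_mono mult_right_mono) (auto simp: entry_sum_nonneg)
        then show ?thesis by (simp add: mult_ac)
      qed
    qed (rule P)
    then show ?case by (simp add: mult_ac)
  qed
  show ?thesis by (rule second[OF e(2) rank])
qed

definition bochi_const :: "nat \<Rightarrow> real \<Rightarrow> real"
  where "bochi_const d s = real (d * d) powr s * (real (d * d) * (real d powr s * real d) ^ d * (3 * 2 powr s) ^ d)"

text \<open>
  In the basis adapted to the contracted gauge \<open>f\<close>, an entry from \<open>e\<close> to \<open>e'\<close> is controlled by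
  \<open>f e' |A\<^sub>w e \<bullet> e'|\<^sup>s \<le> K f (A\<^sub>w e)\<close>. Summing over \<open>w\<close> and using the contraction gives at most
  \<open>K q\<^sup>n f e\<close>, and \<open>f\<close> cancels if \<open>f e \<le> f e'\<close>. Ranks in a basis of \<open>d\<close> elements are below \<open>d\<close>, hence
  after \<open>d\<close> blocks the rank condition of \<open>entry_sum_block_bound\<close> holds for every pair.
\<close>
lemma norm_sum_bochi_inequality:
  fixes A :: "real^'d^'d^'m"
  assumes s: "0 \<le> s" and N: "0 < N" and q: "0 < q" and qN: "norm_sum A s N \<le> q ^ N"
  shows "norm_sum A s n * norm_sum A s (CARD('d) * n)
    \<le> bochi_const CARD('d) s * q ^ n * norm_sum A s n ^ CARD('d)"
proof -
  let ?d = "CARD('d)"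
  define P where "P = norm_sum A s n"
  have P: "0 \<le> P" by (simp add: P_def norm_sum_nonneg)
  obtain f where f: "powr_gauge s f"
    and contr: "\<And>n v. (\<Sum>w | length w = n. f (word_prod A w *v v)) \<le> q ^ n * f v"
    using exists_contracted_powr_gauge[OF s N q qN] by blast
  obtain B where B: "finite B" "card B = ?d" "pairwise orthogonal B" "\<And>e. e \<in> B \<Longrightarrow> norm e = 1"
      "\<And>v. (\<Sum>e\<in>B. (v \<bullet> e) *\<^sub>R e) = v"
    and adapted: "\<And>v e. e \<in> B \<Longrightarrow> f e * \<bar>v \<bullet> e\<bar> powr s \<le> (3 * 2 powr s) ^ ?d * f v"
    using powr_gauge_orthonormal_basis[OF f s subspace_UNIV] by auto
  define X where "X = (3 * 2 powr s) ^ ?d * q ^ n"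
  define D where "D = real ?d powr s * real ?d"
  have X: "0 \<le> X" using q by (simp add: X_def)
  have f1: "1 \<le> f e" if "e \<in> B" for e
    using f B(4)[OF that] unfolding powr_gauge_def by (metis powr_one_eq_one)
  have up: "entry_sum A s n e e' \<le> X" if "e \<in> B" "e' \<in> B" "f e \<le> f e'" for e e'
  proof -
    have "f e' * entry_sum A s n e e'
        \<le> (\<Sum>w | length w = n. (3 * 2 powr s) ^ ?d * f (word_prod A w *v e))"
      unfolding entry_sum_def sum_distrib_left by (intro sum_mono adapted that)
    also have "\<dots> = (3 * 2 powr s) ^ ?d * (\<Sum>w | length w = n. f (word_prod A w *v e))"
      by (simp add: sum_distrib_left)
    also have "\<dots> \<le> (3 * 2 powr s) ^ ?d * (q ^ n * f e)"
      by (intro mult_left_mono contr) auto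
    also have "\<dots> \<le> (3 * 2 powr s) ^ ?d * (q ^ n * f e')"
      using q that(3) by (intro mult_left_mono) auto
    finally have "f e' * entry_sum A s n e e' \<le> f e' * X" by (simp add: X_def mult_ac)
    then show ?thesis using f1[OF that(2)] by simp
  qed
  have entry: "P * entry_sum A s (?d * n) e e' \<le> D ^ ?d * (X * P ^ ?d)" if "e \<in> B" "e' \<in> B" for e e'
  proof -
    have "card {b \<in> B. f b < f e} < ?d"
      using that(1) B(1,2) by (metis (no_types, lifting) less_irrefl mem_Collect_eq psubsetI psubset_card_mono subsetI)
    then show ?thesis
      using entry_sum_block_bound[where k = ?d, OF B(1,3,4,5) s X up that] B(2)
      by (simp add: P_def D_def mult.commute)
  qed
  have card: "card (B \<times> B) = ?d * ?d" using B(1,2) by (simp add: card_cartesian_product)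
  have "P * norm_sum A s (?d * n)
      \<le> P * (real (card (B \<times> B)) powr s * (\<Sum>(e, e')\<in>B \<times> B. entry_sum A s (?d * n) e e'))"
    by (intro mult_left_mono norm_sum_le_entry_sum B s P)
  also have "\<dots> = real (card (B \<times> B)) powr s * (\<Sum>p\<in>B \<times> B. P * entry_sum A s (?d * n) (fst p) (snd p))"
    by (simp add: sum_distrib_left case_prod_unfold mult_ac)
  also have "\<dots> \<le> real (card (B \<times> B)) powr s * (real (card (B \<times> B)) * (D ^ ?d * (X * P ^ ?d)))"
    using entry by (intro mult_left_mono sum_bounded_above) auto
  also have "\<dots> = bochi_const ?d s * q ^ n * P ^ ?d"
    by (simp only: card bochi_const_def X_def D_def mult_ac)
  finally show ?thesis by (simp only: P_def)
qed

section \<open>Continuity of limits squeezed between continuous functions\<close>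

text \<open>
  A supremum of continuous functions is lower semicontinuous and an infimum is upper semicontinuous;
  convergence of the bounds to \<open>\<mu>\<close> makes \<open>\<mu>\<close> both.
\<close>
lemma continuous_on_squeezed_limit:
  fixes \<mu> :: "'a::topological_space \<Rightarrow> real"
  assumes cont: "\<And>n. 0 < n \<Longrightarrow> continuous_on S (lo n)" "\<And>n. 0 < n \<Longrightarrow> continuous_on S (hi n)"
    and bounds: "\<And>n x. 0 < n \<Longrightarrow> x \<in> S \<Longrightarrow> lo n x \<le> \<mu> x" "\<And>n x. 0 < n \<Longrightarrow> x \<in> S \<Longrightarrow> \<mu> x \<le> hi n x"
    and lims: "\<And>x. x \<in> S \<Longrightarrow> (\<lambda>n. lo n x) \<longlonglongrightarrow> \<mu> x" "\<And>x. x \<in> S \<Longrightarrow> (\<lambda>n. hi n x) \<longlonglongrightarrow> \<mu> x"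
  shows "continuous_on S \<mu>"
  unfolding continuous_on_def
proof
  fix x assume x: "x \<in> S"
  have inS: "\<forall>\<^sub>F y in at x within S. y \<in> S"
    by (simp add: eventually_at_filter)
  show "(\<mu> \<longlongrightarrow> \<mu> x) (at x within S)"
  proof (rule order_tendstoI)
    fix a assume "a < \<mu> x"
    then have "\<forall>\<^sub>F n in sequentially. a < lo n x \<and> 0 < n"
      using order_tendstoD(1)[OF lims(1)[OF x]] eventually_gt_at_top[of 0] by (simp add: eventually_conj_iff)
    then obtain n where n: "a < lo n x" "0 < n"
      by (metis (mono_tags, lifting) eventually_sequentially order_refl)
    have "\<forall>\<^sub>F y in at x within S. a < lo n y"
      using cont(1)[OF n(2)] n(1) x by (auto simp: continuous_on_def intro: order_tendstoD)
    with inS show "\<forall>\<^sub>F y in at x within S. a < \<mu> y"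
      by eventually_elim (use bounds(1)[OF n(2)] in fastforce)
  next
    fix a assume "\<mu> x < a"
    then have "\<forall>\<^sub>F n in sequentially. hi n x < a \<and> 0 < n"
      using order_tendstoD(2)[OF lims(2)[OF x]] eventually_gt_at_top[of 0] by (simp add: eventually_conj_iff)
    then obtain n where n: "hi n x < a" "0 < n"
      by (metis (mono_tags, lifting) eventually_sequentially order_refl)
    have "\<forall>\<^sub>F y in at x within S. hi n y < a"
      using cont(2)[OF n(2)] n(1) x by (auto simp: continuous_on_def intro: order_tendstoD)
    with inS show "\<forall>\<^sub>F y in at x within S. \<mu> y < a"
      by eventually_elim (use bounds(2)[OF n(2)] in fastforce)
  qed
qed

text \<open>
  Fekete's lemma: the limit is the infimum \<open>I\<close> of \<open>L n / n\<close>. If \<open>L n / n\<close> is close to \<open>I\<close>, division of \<open>m\<close>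
  by \<open>n\<close> with remainder bounds \<open>L m / m\<close> by \<open>L n / n\<close> plus an error of order \<open>1 / m\<close>.
\<close>
lemma subadditive_limit:
  fixes L :: "nat \<Rightarrow> real"
  assumes sub: "\<And>a b. L (a + b) \<le> L a + L b" and bdd: "\<And>n. 0 < n \<Longrightarrow> b \<le> L n / n"
  obtains \<mu> where "(\<lambda>n. L n / n) \<longlonglongrightarrow> \<mu>" "\<And>n. 0 < n \<Longrightarrow> \<mu> \<le> L n / n"
proof -
  define I where "I = Inf ((\<lambda>n. L n / n) ` {0<..})"
  have bb: "bdd_below ((\<lambda>n. L n / real n) ` {0<..})"
    using bdd by (intro bdd_belowI2[of _ b]) auto
  have I_le: "I \<le> L n / n" if "0 < n" for n
    unfolding I_def using that by (intro cInf_lower bb) auto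
  have mult: "L (k * n) \<le> k * L n" if "0 < k" for k n
    using that
  proof (induction k rule: nat_induct_non_zero)
    case (Suc k)
    then show ?case using sub[of n "k * n"] by (simp add: algebra_simps)
  qed simp
  have upper: "\<forall>\<^sub>F m in sequentially. L m / m < a" if a: "I < a" for a
  proof -
    obtain n where n: "0 < n" "L n / n < a"
      using cInf_less_iff[OF _ bb, of a] a unfolding I_def[symmetric] by auto
    define C where "C = \<bar>L n\<bar> + (\<Sum>r<n. \<bar>L r\<bar>)"
    have "L m / m \<le> L n / n + C / m" if m: "n \<le> m" for m
    proof -
      let ?q = "m div n" and ?r = "m mod n"
      have "0 < ?q" using n(1) m by (simp add: div_greater_zero_iff)
      have split: "L m \<le> L (?q * n) + L ?r" using sub[of "?q * n" ?r] by simp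
      have quot: "L (?q * n) \<le> ?q * L n" using \<open>0 < ?q\<close> by (rule mult)
      have avg: "?q * L n = m * (L n / n) - (?r / n) * L n"
      proof -
        have "real m = real ?q * real n + real ?r" by (metis div_mult_mod_eq of_nat_add of_nat_mult)
        then have "m * (L n / n) = (real ?q * real n + real ?r) * (L n / n)" by (simp only:)
        also have "\<dots> = ?q * L n + (?r / n) * L n" using n(1) by (simp add: distrib_right add_divide_distrib)
        finally show ?thesis by simp
      qed
      have err: "- ((?r / n) * L n) \<le> \<bar>L n\<bar>"
      proof -
        have "\<bar>(?r / n) * L n\<bar> \<le> 1 * \<bar>L n\<bar>"
          unfolding abs_mult using n(1) by (intro mult_right_mono) auto
        then show ?thesis by linarith
      qed
      have rem: "L ?r \<le> (\<Sum>r<n. \<bar>L r\<bar>)"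
        using member_le_sum[of ?r "{..<n}" "\<lambda>r. \<bar>L r\<bar>"] n(1) by auto
      have "L m \<le> m * (L n / n) + C" using split quot avg err rem unfolding C_def by linarith
      then show ?thesis using n(1) m by (simp add: field_simps)
    qed
    then have "\<forall>\<^sub>F m in sequentially. L m / m \<le> L n / n + C / m"
      by (auto simp: eventually_sequentially)
    moreover have "(\<lambda>m. L n / n + C / real m) \<longlonglongrightarrow> L n / n + 0"
      by (intro tendsto_intros lim_const_over_n)
    then have "\<forall>\<^sub>F m in sequentially. L n / n + C / real m < a"
      using n(2) by (intro order_tendstoD(2)) auto
    ultimately show ?thesis by eventually_elim simp
  qed
  have "(\<lambda>n. L n / n) \<longlonglongrightarrow> I"
  proof (rule order_tendstoI)
    fix a assume "a < I"
    show "\<forall>\<^sub>F n in sequentially. a < L n / n"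
      using eventually_gt_at_top[of 0]
    proof eventually_elim
      fix n :: nat assume "0 < n"
      from \<open>a < I\<close> I_le[OF this] show "a < L n / n" by (rule order_less_le_trans)
    qed
  qed (rule upper)
  with I_le show thesis by (intro that)
qed

text \<open>
  The hypothesis \<open>low\<close> serves twice. With \<open>n = 1\<close> it bounds \<open>L N / N\<close> from below, as Fekete's lemma
  requires. With \<open>N \<rightarrow> \<infinity>\<close> it bounds the limit from below by a continuous function for every \<open>n\<close>.
\<close>
lemma continuous_on_subadditive_rate:
  fixes L :: "nat \<Rightarrow> 'a::topological_space \<Rightarrow> real"
  assumes cont: "\<And>n. continuous_on S (L n)" "continuous_on S c" and d: "0 < d"
    and sub: "\<And>x a b. x \<in> S \<Longrightarrow> L (a + b) x \<le> L a x + L b x"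
    and low: "\<And>x n N. x \<in> S \<Longrightarrow> 0 < N \<Longrightarrow>
      L n x + L (d * n) x \<le> c x + n * (L N x / N) + d * L n x"
  shows "continuous_on S (\<lambda>x. lim (\<lambda>n. L n x / n))"
proof -
  define \<mu> where "\<mu> x = lim (\<lambda>n. L n x / n)" for x
  define lo where "lo n x = (L n x + L (d * n) x - c x - d * L n x) / n" for n x
  have lim: "(\<lambda>n. L n x / n) \<longlonglongrightarrow> \<mu> x" and hi: "\<And>n. 0 < n \<Longrightarrow> \<mu> x \<le> L n x / n" if x: "x \<in> S" for x
  proof -
    have "lo 1 x \<le> L n x / n" if "0 < n" for n
      using low[OF x that, of 1] by (simp add: lo_def)
    from subadditive_limit[of "\<lambda>n. L n x", OF sub[OF x] this]
    obtain l where "(\<lambda>n. L n x / n) \<longlonglongrightarrow> l" "\<And>n. 0 < n \<Longrightarrow> l \<le> L n x / n" by blast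
    then show "(\<lambda>n. L n x / n) \<longlonglongrightarrow> \<mu> x" "\<And>n. 0 < n \<Longrightarrow> \<mu> x \<le> L n x / n"
      by (simp_all add: \<mu>_def limI)
  qed
  have "continuous_on S \<mu>"
  proof (rule continuous_on_squeezed_limit[where lo = lo and hi = "\<lambda>n x. L n x / n"])
    fix n :: nat assume n: "0 < n"
    show "continuous_on S (lo n)" "continuous_on S (\<lambda>x. L n x / n)"
      unfolding lo_def using n by (intro continuous_intros cont; simp)+
    fix x assume x: "x \<in> S"
    show "\<mu> x \<le> L n x / n" using hi[OF x n] .
    have "lo n x \<le> L N x / N" if "0 < N" for N
      using low[OF x that, of n] n by (simp add: lo_def field_simps)
    then have "\<forall>\<^sub>F N in sequentially. lo n x \<le> L N x / N"
      using eventually_gt_at_top[of 0] by (rule eventually_mono[rotated])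
    with lim[OF x] show "lo n x \<le> \<mu> x"
      by (intro tendsto_lowerbound) auto
  next
    fix x assume x: "x \<in> S"
    show "(\<lambda>n. L n x / n) \<longlonglongrightarrow> \<mu> x" by (rule lim[OF x])
    \<comment> \<open>\<open>L (d n) / n\<close> is \<open>d\<close> times a term of the convergent sequence, so \<open>d \<mu> x\<close> cancels in the limit.\<close>
    have "filterlim (\<lambda>n. d * n) at_top sequentially"
      using d by (intro filterlim_subseq strict_monoI) auto
    from filterlim_compose[OF lim[OF x] this]
    have "(\<lambda>n. L (d * n) x / real (d * n)) \<longlonglongrightarrow> \<mu> x" .
    then have "(\<lambda>n. L n x / n + d * (L (d * n) x / real (d * n)) - c x / n - d * (L n x / n))
        \<longlonglongrightarrow> \<mu> x + d * \<mu> x - 0 - d * \<mu> x"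
      by (intro tendsto_intros lim[OF x] lim_const_over_n)
    moreover have "L n x / n + d * (L (d * n) x / real (d * n)) - c x / n - d * (L n x / n) = lo n x" for n
      using d by (simp add: lo_def diff_divide_distrib add_divide_distrib)
    ultimately show "(\<lambda>n. lo n x) \<longlonglongrightarrow> \<mu> x" by simp
  qed
  then show ?thesis by (simp add: \<mu>_def)
qed

section \<open>The norm sums as functions of the matrices and the exponent\<close>

lemma word_prod_snoc: "word_prod A (w @ [i]) = (A $ i) ** word_prod A w"
  by (simp add: word_prod_def)

lemma continuous_on_word_prod: "continuous_on S (\<lambda>A. word_prod A w)"
proof (induction w rule: rev_induct)
  case (snoc i w)
  have "continuous_on S (\<lambda>A. \<chi> j k. \<Sum>l\<in>UNIV. A $ i $ j $ l * word_prod A w $ l $ k)"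
    by (intro continuous_intros snoc)
  then show ?case by (simp add: word_prod_snoc matrix_matrix_mult_def)
qed (simp add: word_prod_def)

lemma op_norm_le_norm: "op_norm B \<le> norm B"
  unfolding op_norm_def
proof (rule onorm_le)
  fix x
  have "norm (B *v x) \<le> L2_set (\<lambda>i. norm (B $ i) * norm x) UNIV"
    unfolding norm_vec_def[of "B *v x"]
    by (intro L2_set_mono) (auto simp: matrix_vector_mul_component Cauchy_Schwarz_ineq2)
  also have "\<dots> = norm B * norm x"
    by (simp add: norm_vec_def[of B] L2_set_left_distrib)
  finally show "norm (B *v x) \<le> norm B * norm x" .
qed

lemma op_norm_lipschitz: "\<bar>op_norm B - op_norm C\<bar> \<le> norm (B - C)"
proof -
  have tri: "op_norm B \<le> op_norm C + op_norm (B - C)" for B C :: "real^'a^'a"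
  proof -
    have "(*v) B = (\<lambda>x. C *v x + (B - C) *v x)"
      by (simp add: fun_eq_iff matrix_vector_mult_diff_rdistrib)
    then show ?thesis
      using onorm_triangle[of "(*v) C" "(*v) (B - C)"] by (simp only: op_norm_def) simp
  qed
  show ?thesis
    using tri[of B C] tri[of C B] op_norm_le_norm[of "B - C"] op_norm_le_norm[of "C - B"]
    by (simp add: norm_minus_commute)
qed

lemma continuous_on_op_norm: "continuous_on S op_norm"
  unfolding continuous_on_iff dist_real_def dist_norm
  using op_norm_lipschitz order_le_less_trans by metis

lemma invertible_word_prod: "A \<in> GL_tuples \<Longrightarrow> invertible (word_prod A w)"
proof (induction w rule: rev_induct)
  case (snoc i w)
  then show ?case by (auto simp: word_prod_snoc GL_tuples_def intro: invertible_mult)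
qed (simp add: word_prod_def invertible_def)

lemma op_norm_pos:
  fixes B :: "real^'d^'d"
  assumes "invertible B"
  shows "0 < op_norm B"
proof -
  have "B *v 1 \<noteq> 0" using assms
    by (metis invertible_def matrix_vector_mul_assoc matrix_vector_mul_lid matrix_vector_mult_0_right zero_neq_one)
  then have "0 < norm (B *v 1)" by simp
  also have "\<dots> \<le> op_norm B * norm (1 :: real^'d)" by (rule norm_matrix_apply_le)
  finally show ?thesis by (metis linorder_not_less mult_nonpos_nonneg norm_ge_zero)
qed

lemma norm_sum_pos:
  fixes A :: "real^'d^'d^'m"
  assumes "A \<in> GL_tuples"
  shows "0 < norm_sum A s n"
  unfolding norm_sum_def
proof (rule sum_pos)
  show "{w :: 'm list. length w = n} \<noteq> {}"
    by (metis (mono_tags) length_replicate empty_Collect_eq)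
  fix w :: "'m list"
  show "0 < op_norm (word_prod A w) powr s"
    using op_norm_pos[OF invertible_word_prod[OF assms], of w] by simp
qed simp

text \<open>
  Invertibility keeps the operator norms positive. This matters at \<open>s = 0\<close>, since \<open>x powr s\<close> is
  discontinuous at \<open>(0, 0)\<close>.
\<close>
lemma continuous_on_norm_sum:
  "continuous_on (GL_tuples \<times> {0..}) (\<lambda>(A :: real^'d^'d^'m, s). norm_sum A s n)"
proof -
  have "continuous_on (GL_tuples \<times> {0..}) (\<lambda>p. op_norm (word_prod (fst p :: real^'d^'d^'m) w) powr snd p)" for w
  proof (rule continuous_on_powr)
    show "continuous_on (GL_tuples \<times> {0..}) (\<lambda>p. op_norm (word_prod (fst p :: real^'d^'d^'m) w))"
      by (intro continuous_on_compose2[OF continuous_on_op_norm[of UNIV]]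
          continuous_on_compose2[OF continuous_on_word_prod[of UNIV]] continuous_intros) auto
    show "\<forall>p\<in>GL_tuples \<times> {0::real..}. op_norm (word_prod (fst p :: real^'d^'d^'m) w) \<noteq> 0"
    proof
      fix p :: "(real^'d^'d^'m) \<times> real"
      assume "p \<in> GL_tuples \<times> {0..}"
      then have "0 < op_norm (word_prod (fst p) w)"
        by (intro op_norm_pos invertible_word_prod) auto
      then show "op_norm (word_prod (fst p) w) \<noteq> 0" by simp
    qed
  qed (intro continuous_intros)
  then show ?thesis
    unfolding norm_sum_def case_prod_unfold by (intro continuous_on_sum)
qed

lemma bochi_const_pos: "0 < d \<Longrightarrow> 0 < bochi_const d s"
  by (simp add: bochi_const_def)

lemma continuous_on_bochi_const: "0 < d \<Longrightarrow> continuous_on S (bochi_const d)"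
  unfolding bochi_const_def by (intro continuous_intros) auto

lemma ln_norm_sum_bochi_inequality:
  fixes A :: "real^'d^'d^'m" and L :: "nat \<Rightarrow> real"
  assumes A: "A \<in> GL_tuples" and s: "0 \<le> s" and N: "0 < N"
  defines "L \<equiv> \<lambda>n. ln (norm_sum A s n)"
  shows "L n + L (CARD('d) * n) \<le> ln (bochi_const CARD('d) s) + n * (L N / N) + CARD('d) * L n"
proof -
  let ?P = "norm_sum A s" and ?C = "bochi_const CARD('d) s"
  \<comment> \<open>The \<open>N\<close>-th root of \<open>norm_sum A s N\<close>, the smallest rate that the contracted gauge allows.\<close>
  define q where "q = exp (L N / N)"
  have pos: "0 < ?P k" for k by (rule norm_sum_pos[OF A])
  have C: "0 < ?C" by (simp add: bochi_const_pos)
  have "q ^ N = exp (L N)" using N by (simp add: q_def flip: exp_of_nat_mult)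
  then have "?P N \<le> q ^ N" using pos by (simp add: L_def)
  then have ineq: "?P n * ?P (CARD('d) * n) \<le> ?C * q ^ n * ?P n ^ CARD('d)"
    using N s by (intro norm_sum_bochi_inequality) (auto simp: q_def)
  have "L n + L (CARD('d) * n) = ln (?P n * ?P (CARD('d) * n))"
    using pos by (simp add: L_def ln_mult_pos)
  also have "\<dots> \<le> ln (?C * q ^ n * ?P n ^ CARD('d))"
    using ineq pos by (subst ln_le_cancel_iff) (auto intro: order_less_le_trans[OF _ ineq])
  also have "\<dots> = ln ?C + n * ln q + CARD('d) * L n"
    using pos C by (simp add: L_def q_def ln_mult_pos ln_realpow)
  finally show ?thesis by (simp add: q_def)
qed

theorem theorem1p2:
  shows "continuous_on ((GL_tuples :: (real^'d^'d^'m) set) \<times> {0..}) (\<lambda>(A, s). M A s)"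
proof -
  let ?S = "(GL_tuples :: (real^'d^'d^'m) set) \<times> {0::real..}"
  have "continuous_on ?S (\<lambda>p. lim (\<lambda>n. ln (norm_sum (fst p) (snd p) n) / n))"
  proof (rule continuous_on_subadditive_rate[where d = "CARD('d)"
        and c = "\<lambda>p. ln (bochi_const CARD('d) (snd p))"])
    show "continuous_on ?S (\<lambda>p. ln (norm_sum (fst p) (snd p) n))" for n
    proof (rule continuous_on_ln)
      show "continuous_on ?S (\<lambda>p. norm_sum (fst p) (snd p) n)"
        using continuous_on_norm_sum[of n] by (simp add: case_prod_unfold)
      show "\<forall>p\<in>?S. norm_sum (fst p) (snd p) n \<noteq> 0"
      proof
        fix p assume "p \<in> ?S"
        then have "0 < norm_sum (fst p) (snd p) n" by (intro norm_sum_pos) auto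
        then show "norm_sum (fst p) (snd p) n \<noteq> 0" by simp
      qed
    qed
    show "continuous_on ?S (\<lambda>p. ln (bochi_const CARD('d) (snd p)))"
      using bochi_const_pos[of "CARD('d)"]
      by (intro continuous_on_ln continuous_on_compose2[OF continuous_on_bochi_const[of _ UNIV]]
          continuous_intros) (auto simp: less_imp_neq[symmetric])
  next
    fix p a b assume p: "p \<in> ?S"
    then have pos: "0 < norm_sum (fst p) (snd p) k" for k by (auto intro: norm_sum_pos)
    have "ln (norm_sum (fst p) (snd p) (a + b)) \<le> ln (norm_sum (fst p) (snd p) a * norm_sum (fst p) (snd p) b)"
      using p pos by (subst ln_le_cancel_iff) (auto intro: norm_sum_add_le)
    then show "ln (norm_sum (fst p) (snd p) (a + b))
        \<le> ln (norm_sum (fst p) (snd p) a) + ln (norm_sum (fst p) (snd p) b)"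
      using pos by (simp add: ln_mult_pos)
  next
    fix p n and N :: nat assume "p \<in> ?S" "0 < N"
    then show "ln (norm_sum (fst p) (snd p) n) + ln (norm_sum (fst p) (snd p) (CARD('d) * n))
        \<le> ln (bochi_const CARD('d) (snd p)) + n * (ln (norm_sum (fst p) (snd p) N) / N)
          + CARD('d) * ln (norm_sum (fst p) (snd p) n)"
      by (intro ln_norm_sum_bochi_inequality) auto
  qed simp
  then show ?thesis by (simp add: M_def case_prod_unfold)
qed

end
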